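(* Let $n\in\{2,3\}$ and let $G\subset O(n)$ be a closed, irreducible subgroup which is not transitive on the unit sphere $S_{n-1}\subset\mathbb{R}^n$. Then $G$ is finite.
   Context: $G$ is irreducible if its only invariant linear subspaces are $\{0\}$ and $\mathbb{R}^n$. $G$ is transitive on $S_{n-1}$ if the orbit of some unit vector is the whole of $S_{n-1}$. *)

theory Defs
  imports "HOL-Analysis.Analysis" "HOL-Algebra.Group"
begin

definition orthogonal_group :: "(real^'n^'n) monoid"
  where "orthogonal_group =
    \<lparr>carrier = {A. orthogonal_matrix A}, mult = (\<lambda>A B. A ** B), one = mat 1\<rparr>"

lemma group_orthogonal_group: "group (orthogonal_group :: (real^'n^'n) monoid)"
proof (rule groupI)
  fix A :: "real^'n^'n"
  assume "A \<in> carrier orthogonal_group"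
  then show "\<exists>B\<in>carrier orthogonal_group. B \<otimes>\<^bsub>orthogonal_group\<^esub> A = \<one>\<^bsub>orthogonal_group\<^esub>"
    by (intro bexI[of _ "transpose A"]) (auto simp: orthogonal_group_def orthogonal_matrix_def)
qed (auto simp: orthogonal_group_def orthogonal_matrix_mul orthogonal_matrix_id matrix_mul_assoc)

definition irreducible_matrices :: "(real^'n^'n) set \<Rightarrow> bool"
  where "irreducible_matrices G \<longleftrightarrow>
    (\<forall>V :: (real^'n) set. subspace V \<and> (\<forall>A\<in>G. (\<lambda>v. A *v v) ` V \<subseteq> V) \<longrightarrow> V = {0} \<or> V = UNIV)"

definition transitive_on_unit_sphere :: "(real^'n^'n) set \<Rightarrow> bool"
  where "transitive_on_unit_sphere G \<longleftrightarrow>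
    (\<exists>v \<in> sphere (0 :: real^'n) 1. (\<lambda>A. A *v v) ` G = sphere 0 1)"

end

theory Submission
  imports Defs
begin

text \<open>Suppose that \<open>G\<close> is infinite. Rescaling elements of \<open>G\<close> that converge to the identity gives a
  nonzero tangent direction, and every tangent direction is a skew-symmetric matrix \<open>A\<close>. Given unit
  vectors \<open>v\<close> and \<open>y\<close>, let \<open>x\<close> be the point of the compact orbit \<open>G v\<close> closest to \<open>y\<close>; then \<open>A x\<close> is
  orthogonal to \<open>y\<close> for all tangent directions \<open>A\<close>. If \<open>x\<close> and \<open>y\<close> were linearly independent, every
  nonzero tangent direction would map the plane they span onto its orthogonal complement \<open>N\<close>, which
  has dimension at most 1; so \<open>N\<close> would be nonzero and lie in the range of all of them. By irreducibility the intersection of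
  these ranges, which is invariant under \<open>G\<close>, would be the whole space, although every \<open>A\<close> has a
  kernel on the plane. Hence \<open>x = y\<close> or \<open>x = - y\<close>, and in the second case the orbit is a single
  point, which contradicts irreducibility. So the orbit is the whole sphere.\<close>

text \<open>This is a sequential tangent cone at the identity. Neither linearity of the cone nor
  exponentials of its elements enter, so no Lie theory of closed subgroups is invoked.\<close>

definition tangent_at_identity :: "(real^'n^'n) set \<Rightarrow> real^'n^'n \<Rightarrow> bool"
  where "tangent_at_identity G A \<longleftrightarrow>
    (\<exists>h t. (\<forall>k::nat. h k \<in> G \<and> t k > 0) \<and> t \<longlonglongrightarrow> 0 \<and>
      (\<lambda>k. inverse (t k) *\<^sub>R (h k - mat 1)) \<longlonglongrightarrow> A)"

section \<open>Orthogonal matrices and limits of matrix products\<close>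

lemma inner_matrix_vector_left:
  fixes A :: "real^'n^'m"
  shows "(A *v u) \<bullet> v = u \<bullet> (transpose A *v v)"
  by (metis dot_lmul_matrix inner_commute transpose_matrix_vector)

lemma orthogonal_matrix_inner:
  fixes A :: "real^'n^'n"
  assumes "orthogonal_matrix A"
  shows "(A *v u) \<bullet> (A *v v) = u \<bullet> v"
  using assms
  by (simp add: inner_matrix_vector_left matrix_vector_mul_assoc orthogonal_matrix)

lemma bounded_orthogonal_matrices:
  "bounded {A :: real^'n^'n. orthogonal_matrix A}"
proof (rule boundedI)
  fix A :: "real^'n^'n"
  assume "A \<in> {A. orthogonal_matrix A}"
  then have "norm (A $ i) = 1" for i
    by (auto simp: orthogonal_matrix_orthonormal_rows row_def)
  moreover have "norm A \<le> (\<Sum>i\<in>UNIV. norm (A $ i))"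
    unfolding norm_vec_def[of A] by (rule L2_set_le_sum) simp
  ultimately show "norm A \<le> CARD('n)"
    by simp
qed

lemma tendsto_matrix_vector_mult:
  fixes B :: "'a \<Rightarrow> real^'n^'m"
  assumes "(B \<longlongrightarrow> A) F"
  shows "((\<lambda>k. B k *v v) \<longlongrightarrow> A *v v) F"
  by (rule vec_tendstoI) (auto simp: matrix_vector_mult_def intro!: tendsto_intros assms)

text \<open>The independent factors \<open>P\<close> and \<open>Q\<close> serve both conjugation
  and, with \<open>Q\<close> equal to \<open>mat 1\<close>, left translation.\<close>

lemma tendsto_matrix_conjugate:
  fixes B :: "'a \<Rightarrow> real^'n^'n"
  assumes "(B \<longlongrightarrow> A) F"
  shows "((\<lambda>k. P ** B k ** Q) \<longlongrightarrow> P ** A ** Q) F"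
  by (rule vec_tendstoI, rule vec_tendstoI)
    (auto simp: matrix_matrix_mult_def intro!: tendsto_intros assms)

section \<open>Tangent directions of an orthogonal group\<close>

context
  fixes G :: "(real^'n^'n) set"
  assumes G: "subgroup G orthogonal_group"
begin

lemma subgroup_orthogonal_matrix: "A \<in> G \<Longrightarrow> orthogonal_matrix A"
  using subgroup.subset[OF G] by (auto simp: orthogonal_group_def)

lemma subgroup_mat_1: "mat 1 \<in> G"
  using subgroup.one_closed[OF G] by (simp add: orthogonal_group_def)

lemma subgroup_matrix_mult: "A \<in> G \<Longrightarrow> B \<in> G \<Longrightarrow> A ** B \<in> G"
  using subgroup.m_closed[OF G, of A B] by (simp add: orthogonal_group_def)

lemma subgroup_transpose:
  assumes "A \<in> G"
  shows "transpose A \<in> G"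
proof -
  interpret orthogonal_group: group "orthogonal_group :: (real^'n^'n) monoid"
    by (rule group_orthogonal_group)
  have "orthogonal_matrix A"
    using assms by (rule subgroup_orthogonal_matrix)
  then have "inv\<^bsub>orthogonal_group\<^esub> A = transpose A"
    by (intro orthogonal_group.inv_equality) (auto simp: orthogonal_group_def orthogonal_matrix_def)
  then show ?thesis
    using subgroup.m_inv_closed[OF G assms] by simp
qed

text \<open>Expanding the preserved squared norm of \<open>v + t k *\<^sub>R (B k *v v)\<close> and
  dividing by \<open>t k\<close> leaves a term that vanishes in the limit.\<close>

lemma tangent_at_identity_skew_self:
  assumes "tangent_at_identity G A"
  shows "v \<bullet> (A *v v) = 0"
proof -
  obtain h t where h: "\<And>k::nat. h k \<in> G" and t: "\<And>k. t k > 0" "t \<longlonglongrightarrow> 0"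
    and lim: "(\<lambda>k. inverse (t k) *\<^sub>R (h k - mat 1)) \<longlonglongrightarrow> A"
    using assms unfolding tangent_at_identity_def by blast
  define B where "B = (\<lambda>k. inverse (t k) *\<^sub>R (h k - mat 1))"
  have Bv: "(\<lambda>k. B k *v v) \<longlonglongrightarrow> A *v v"
    using lim unfolding B_def by (rule tendsto_matrix_vector_mult)
  have "2 * (v \<bullet> (B k *v v)) + t k * ((B k *v v) \<bullet> (B k *v v)) = 0" for k
  proof -
    have eq: "h k *v v = v + t k *\<^sub>R (B k *v v)"
      using t(1)[of k]
      by (simp add: B_def scaleR_matrix_vector_assoc[symmetric] matrix_vector_mult_diff_rdistrib)
    have "(h k *v v) \<bullet> (h k *v v) = v \<bullet> v"
      by (rule orthogonal_matrix_inner[OF subgroup_orthogonal_matrix[OF h]])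
    then have "t k * (2 * (v \<bullet> (B k *v v)) + t k * ((B k *v v) \<bullet> (B k *v v))) = 0"
      unfolding eq by (simp add: inner_add inner_commute algebra_simps)
    then show ?thesis
      using t(1)[of k] by simp
  qed
  moreover have "(\<lambda>k. 2 * (v \<bullet> (B k *v v)) + t k * ((B k *v v) \<bullet> (B k *v v)))
    \<longlonglongrightarrow> 2 * (v \<bullet> (A *v v)) + 0 * ((A *v v) \<bullet> (A *v v))"
    by (intro tendsto_intros Bv t)
  ultimately show ?thesis
    by (simp add: LIMSEQ_const_iff)
qed

lemma tangent_at_identity_skew:
  assumes "tangent_at_identity G A"
  shows "(A *v u) \<bullet> v = - (u \<bullet> (A *v v))"
  using tangent_at_identity_skew_self[OF assms, of "u + v"]
    tangent_at_identity_skew_self[OF assms, of u] tangent_at_identity_skew_self[OF assms, of v]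
  by (simp add: matrix_vector_right_distrib inner_add inner_commute)

text \<open>Conjugating the approximating sequence keeps it in \<open>G\<close> with the same scale
  \<open>t\<close>. This is what later makes the intersection of ranges invariant.\<close>

lemma tangent_at_identity_conjugate:
  assumes "tangent_at_identity G A" and g: "g \<in> G"
  shows "tangent_at_identity G (g ** A ** transpose g)"
proof -
  obtain h t where h: "\<And>k::nat. h k \<in> G" and t: "\<And>k. t k > 0" "t \<longlonglongrightarrow> 0"
    and lim: "(\<lambda>k. inverse (t k) *\<^sub>R (h k - mat 1)) \<longlonglongrightarrow> A"
    using assms unfolding tangent_at_identity_def by blast
  have "g ** transpose g = mat 1"
    using subgroup_orthogonal_matrix[OF g] by (simp add: orthogonal_matrix_def)
  then have "g *v (transpose g *v w) = w" for w
    by (simp add: matrix_vector_mul_assoc del: transpose_matrix_vector)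
  then have "g ** (inverse (t k) *\<^sub>R (h k - mat 1)) ** transpose g =
      inverse (t k) *\<^sub>R (g ** h k ** transpose g - mat 1)" for k
    by (simp add: matrix_eq matrix_vector_mul_assoc[symmetric] scaleR_matrix_vector_assoc[symmetric]
        matrix_vector_mult_diff_rdistrib matrix_vector_mult_diff_distrib
        matrix_vector_mult_scaleR del: transpose_matrix_vector)
  then have "(\<lambda>k. inverse (t k) *\<^sub>R (g ** h k ** transpose g - mat 1))
      \<longlonglongrightarrow> g ** A ** transpose g"
    using tendsto_matrix_conjugate[OF lim, of g "transpose g"] by simp
  moreover have "g ** h k ** transpose g \<in> G" for k
    by (intro subgroup_matrix_mult subgroup_transpose g h)
  ultimately show ?thesis
    using t unfolding tangent_at_identity_def
    by (intro exI[of _ "\<lambda>k. g ** h k ** transpose g"] exI[of _ t]) auto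
qed

section \<open>Compactness and a nonzero tangent direction\<close>

lemma compact_subgroup:
  assumes "closed G"
  shows "compact G"
  using assms bounded_subset[OF bounded_orthogonal_matrices, of G] subgroup_orthogonal_matrix
  by (auto simp: compact_eq_bounded_closed)

lemma nonzero_tangent_at_identity:
  assumes "closed G" "infinite G"
  obtains A where "tangent_at_identity G A" "A \<noteq> 0"
proof -
  obtain g where g: "g \<in> G" "g islimpt G"
    using compact_subgroup[OF assms(1)] assms(2)
    unfolding compact_eq_Bolzano_Weierstrass by blast
  then obtain f where f: "\<And>k::nat. f k \<in> G - {g}" "f \<longlonglongrightarrow> g"
    unfolding islimpt_sequential by blast
  have gg: "transpose g ** g = mat 1" "g ** transpose g = mat 1"
    using subgroup_orthogonal_matrix[OF g(1)] by (simp_all add: orthogonal_matrix_def)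
  \<comment> \<open>Left translation by the inverse of \<open>g\<close> moves the accumulation point
    to the identity.\<close>
  define h where "h = (\<lambda>k. transpose g ** f k)"
  define t where "t = (\<lambda>k. norm (h k - mat 1))"
  have hG: "h k \<in> G" for k
    unfolding h_def using f(1)[of k] g(1) by (auto intro: subgroup_matrix_mult subgroup_transpose)
  have "h k \<noteq> mat 1" for k
  proof
    assume "h k = mat 1"
    then have "g ** (transpose g ** f k) = g"
      by (simp add: h_def)
    then have "f k = g"
      by (simp add: matrix_mul_assoc gg)
    then show False
      using f(1)[of k] by simp
  qed
  then have tpos: "t k > 0" for k
    by (simp add: t_def)
  have "h \<longlonglongrightarrow> mat 1"
    using tendsto_matrix_conjugate[OF f(2), of "transpose g" "mat 1"] by (simp add: h_def gg)
  then have t0: "t \<longlonglongrightarrow> 0"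
    unfolding t_def by (intro tendsto_norm_zero) (simp add: LIM_zero_iff)
  \<comment> \<open>Scaling to norm 1 keeps the limit of a convergent subsequence on the compact
    unit sphere of matrices, so it cannot be 0.\<close>
  define B where "B = (\<lambda>k. inverse (t k) *\<^sub>R (h k - mat 1))"
  have normB: "B k \<in> sphere 0 1" for k
    using tpos[of k] by (simp add: B_def t_def)
  have "seq_compact (sphere (0 :: real^'n^'n) 1)"
    by (intro compact_imp_seq_compact compact_sphere)
  then obtain A r where A: "A \<in> sphere 0 1" and r: "strict_mono (r :: nat \<Rightarrow> nat)"
    and lim: "(B \<circ> r) \<longlonglongrightarrow> A"
    using normB unfolding seq_compact_def by meson
  have "tangent_at_identity G A"
    unfolding tangent_at_identity_def
    using hG tpos lim LIMSEQ_subseq_LIMSEQ[OF t0 r]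
    by (intro exI[of _ "h \<circ> r"] exI[of _ "t \<circ> r"]) (auto simp: B_def o_def)
  moreover have "A \<noteq> 0"
    using A by auto
  ultimately show ?thesis
    by (rule that)
qed

text \<open>First-order optimality of \<open>x\<close> along curves of \<open>G\<close>. The inequality for \<open>A\<close> comes from
  \<open>h k\<close>, the opposite one from the inverses \<open>transpose (h k)\<close>.\<close>

lemma tangent_at_identity_maximizer:
  assumes "tangent_at_identity G A"
    and max: "\<And>g. g \<in> G \<Longrightarrow> (g *v x) \<bullet> y \<le> x \<bullet> y"
  shows "(A *v x) \<bullet> y = 0"
proof -
  obtain h t where h: "\<And>k::nat. h k \<in> G" and t: "\<And>k. t k > 0" "t \<longlonglongrightarrow> 0"
    and lim: "(\<lambda>k. inverse (t k) *\<^sub>R (h k - mat 1)) \<longlonglongrightarrow> A"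
    using assms(1) unfolding tangent_at_identity_def by blast
  define B where "B = (\<lambda>k. inverse (t k) *\<^sub>R (h k - mat 1))"
  have Bv: "(\<lambda>k. B k *v v) \<longlonglongrightarrow> A *v v" for v
    using lim unfolding B_def by (rule tendsto_matrix_vector_mult)
  have B_eq: "B k *v v = inverse (t k) *\<^sub>R (h k *v v - v)" for k v
    by (simp add: B_def scaleR_matrix_vector_assoc[symmetric] matrix_vector_mult_diff_rdistrib)
  have "(B k *v x) \<bullet> y \<le> 0" for k
    using max[OF h, of k] t(1)[of k]
    by (simp add: B_eq inner_diff mult_nonneg_nonpos)
  then have "(A *v x) \<bullet> y \<le> 0"
    by (intro LIMSEQ_le_const2[OF tendsto_inner[OF Bv tendsto_const]]) auto
  moreover have "x \<bullet> (B k *v y) \<le> 0" for k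
  proof -
    have "x \<bullet> (h k *v y) \<le> x \<bullet> y"
      using max[OF subgroup_transpose[OF h], of k]
      unfolding inner_matrix_vector_left transpose_transpose .
    then show ?thesis
      using t(1)[of k] by (simp add: B_eq inner_diff mult_nonneg_nonpos)
  qed
  then have "x \<bullet> (A *v y) \<le> 0"
    by (intro LIMSEQ_le_const2[OF tendsto_inner[OF tendsto_const Bv]]) auto
  ultimately show ?thesis
    using tangent_at_identity_skew[OF assms(1), of x y] by simp
qed

section \<open>Nearest orbit points are parallel to the target\<close>

lemma maximizer_parallel:
  assumes card: "CARD('n) \<le> 3"
    and irr: "irreducible_matrices G"
    and "tangent_at_identity G A0" "A0 \<noteq> 0"
    and max: "\<And>g. g \<in> G \<Longrightarrow> (g *v x) \<bullet> y \<le> x \<bullet> y"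
    and xy: "norm x = 1" "norm y = 1"
  shows "x = y \<or> x = - y"
proof (rule ccontr)
  assume neq: "\<not> (x = y \<or> x = - y)"
  have ne0: "x \<noteq> 0" "y \<noteq> 0"
    using xy by auto
  have xspan: "x \<notin> span {y}"
  proof
    assume "x \<in> span {y}"
    then obtain c where c: "x = c *\<^sub>R y"
      by (auto simp: span_singleton)
    then have "\<bar>c\<bar> = 1"
      using xy by simp
    then show False
      using neq c by (auto simp: abs_if split: if_splits)
  qed
  \<comment> \<open>The orthogonal complement of the plane spanned by \<open>x\<close> and
    \<open>y\<close>; in dimension at most 3 it is a line or 0.\<close>
  define Q where "Q = {q. q \<bullet> x = 0 \<and> q \<bullet> y = 0}"
  have "dim (span {x, y}) = 2"
    using xspan ne0 by (simp add: dim_insert)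
  moreover have "{q \<in> UNIV. \<forall>p \<in> span {x, y}. orthogonal p q} = Q"
  proof
    show "{q \<in> UNIV. \<forall>p \<in> span {x, y}. orthogonal p q} \<subseteq> Q"
      by (auto simp: Q_def orthogonal_def inner_commute intro: span_base)
    show "Q \<subseteq> {q \<in> UNIV. \<forall>p \<in> span {x, y}. orthogonal p q}"
    proof clarsimp
      fix q p
      assume q: "q \<in> Q" and p: "p \<in> span {x, y}"
      have "orthogonal q p"
        using q by (intro orthogonal_to_span[OF p]) (auto simp: Q_def orthogonal_def)
      then show "orthogonal p q"
        by (simp add: orthogonal_commute)
    qed
  qed
  ultimately have "dim Q + 2 = CARD('n)"
    using dim_subspace_orthogonal_to_vectors[of "span {x, y}" "UNIV :: (real^'n) set"] by simp
  then have dimQ: "dim Q \<le> 1"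
    using card by simp
  have subQ: "subspace Q"
    by (auto simp: Q_def subspace_def inner_add)
  \<comment> \<open>If \<open>Q\<close> is trivial then \<open>n\<close> is 0;
    \<open>n_range\<close> excludes this once a nonzero tangent direction is at hand.\<close>
  obtain n where n: "n \<in> Q" "\<And>q. q \<in> Q \<Longrightarrow> \<exists>c. q = c *\<^sub>R n"
  proof (cases "dim Q = 0")
    case True
    then show ?thesis
      using that[of 0] subspace_0[OF subQ] by auto
  next
    case False
    obtain B where B: "B \<subseteq> Q" "independent B" "Q \<subseteq> span B" "card B = dim Q"
      using basis_exists by blast
    then have "card B = 1"
      using dimQ False by linarith
    then obtain b where "B = {b}"
      by (auto simp: card_1_singleton_iff)
    then show ?thesis
      using that[of b] B by (auto simp: span_singleton)
  qed
  have img: "A *v x \<in> Q" "A *v y \<in> Q" if "tangent_at_identity G A" for A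
  proof -
    have "(A *v x) \<bullet> y = 0"
      using that max by (rule tangent_at_identity_maximizer)
    then show "A *v x \<in> Q" "A *v y \<in> Q"
      using tangent_at_identity_skew[OF that, of x y] tangent_at_identity_skew_self[OF that, of x]
        tangent_at_identity_skew_self[OF that, of y]
      by (auto simp: Q_def inner_commute)
  qed
  \<comment> \<open>Skewness puts the range of such an \<open>A\<close> into \<open>Q\<close>. Then
    \<open>A *v n\<close> is both a multiple of \<open>n\<close> and orthogonal to it, hence 0, and
    skewness again makes the range orthogonal to \<open>n\<close>.\<close>
  have zero: "A = 0" if A: "tangent_at_identity G A" and A0: "A *v x = 0" "A *v y = 0" for A
  proof -
    note skew = tangent_at_identity_skew[OF A]
    have inQ: "A *v v \<in> Q" for v
      by (simp add: Q_def skew A0)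
    then obtain c where c: "A *v n = c *\<^sub>R n"
      using n(2) by blast
    have "n \<bullet> (A *v n) = 0"
      by (rule tangent_at_identity_skew_self[OF A])
    then have An: "A *v n = 0"
      using c by auto
    have "A *v v = 0" for v
    proof -
      obtain c where c: "A *v v = c *\<^sub>R n"
        using inQ n(2) by blast
      have "(A *v v) \<bullet> n = 0"
        by (simp add: skew An)
      then show ?thesis
        using c by auto
    qed
    then show ?thesis
      by (subst matrix_eq) simp
  qed
  \<comment> \<open>By \<open>zero\<close>, one of \<open>x\<close> and \<open>y\<close> has a
    nonzero image; it lies in \<open>Q\<close>, so rescaling it gives \<open>n\<close>.\<close>
  have n_range: "n \<noteq> 0 \<and> n \<in> range ((*v) A)" if A: "tangent_at_identity G A" "A \<noteq> 0" for A
  proof -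
    obtain w where w: "A *v w \<in> Q" "A *v w \<noteq> 0"
      using zero[OF A(1)] A(2) img[OF A(1)] by blast
    then obtain c where c: "A *v w = c *\<^sub>R n"
      using n(2) by blast
    then have "n = A *v (inverse c *\<^sub>R w)" "n \<noteq> 0"
      using w(2) by (auto simp: matrix_vector_mult_scaleR)
    then show ?thesis
      by blast
  qed
  define U where "U = {v. \<forall>A. tangent_at_identity G A \<and> A \<noteq> 0 \<longrightarrow> v \<in> range ((*v) A)}"
  have "subspace U"
  proof -
    have "U = \<Inter> {range ((*v) A) |A. tangent_at_identity G A \<and> A \<noteq> 0}"
      by (auto simp: U_def)
    moreover have "subspace (range ((*v) A))" for A :: "real^'n^'n"
      by (intro linear_subspace_image matrix_vector_mul_linear subspace_UNIV)
    ultimately show ?thesis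
      by (auto intro!: subspace_Inter)
  qed
  moreover have "g *v v \<in> U" if g: "g \<in> G" and v: "v \<in> U" for g v
    unfolding U_def
  proof safe
    fix A :: "real^'n^'n"
    assume A: "tangent_at_identity G A" "A \<noteq> 0"
    have gg: "g ** transpose g = mat 1"
      using subgroup_orthogonal_matrix[OF g] by (simp add: orthogonal_matrix_def)
    \<comment> \<open>Since \<open>g ** C = A ** g\<close>, \<open>g\<close> carries the range of
      \<open>C\<close> into that of \<open>A\<close>. As \<open>U\<close> involves only nonzero
      directions, \<open>C\<close> must be shown nonzero.\<close>
    define C where "C = transpose g ** A ** g"
    have "tangent_at_identity G C"
      using tangent_at_identity_conjugate[OF A(1) subgroup_transpose[OF g]] by (simp add: C_def)
    moreover have gC: "g ** C = A ** g"
      by (simp add: C_def matrix_mul_assoc gg)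
    have "C \<noteq> 0"
    proof
      assume "C = 0"
      then have "(A ** g) ** transpose g = 0"
        by (simp flip: gC)
      then have "A = 0"
        by (simp add: gg flip: matrix_mul_assoc)
      with A(2) show False ..
    qed
    ultimately obtain w where "v = C *v w"
      using v unfolding U_def by blast
    then have "g *v v = A *v (g *v w)"
      by (simp add: matrix_vector_mul_assoc gC)
    then show "g *v v \<in> range ((*v) A)"
      by blast
  qed
  then have "\<forall>g\<in>G. (*v) g ` U \<subseteq> U"
    by blast
  ultimately have "U = {0} \<or> U = UNIV"
    using irr unfolding irreducible_matrices_def by blast
  moreover have "n \<in> U" "n \<noteq> 0"
    using n_range n_range[OF assms(3,4)] by (auto simp: U_def)
  ultimately have "U = UNIV"
    by blast
  then have "surj ((*v) A0)"
    using assms(3,4) unfolding U_def by blast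
  then have inj: "inj ((*v) A0)"
    by (intro linear_surj_imp_inj matrix_vector_mul_linear)
  obtain a b where ab: "A0 *v x = a *\<^sub>R n" "A0 *v y = b *\<^sub>R n"
    using img[OF assms(3)] n(2) by meson
  \<comment> \<open>Two vectors mapped into one line admit a linear combination in the kernel;
    injectivity turns it into a dependence of \<open>x\<close> and \<open>y\<close>.\<close>
  have "A0 *v (b *\<^sub>R x) = A0 *v (a *\<^sub>R y)"
    by (simp add: matrix_vector_mult_scaleR ab)
  then have "b *\<^sub>R x = a *\<^sub>R y"
    using inj by (rule injD[rotated])
  moreover have "b \<noteq> 0"
  proof
    assume "b = 0"
    then have "A0 *v y = A0 *v 0"
      using ab by simp
    then show False
      using injD[OF inj] ne0 by blast
  qed
  then have "x = inverse b *\<^sub>R (b *\<^sub>R x)"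
    by simp
  ultimately have "x \<in> span {y}"
    by (metis insertI1 span_base span_mul)
  then show False
    using xspan by contradiction
qed

end

section \<open>The orbit fills the sphere\<close>

theorem corollary8:
  fixes G :: "(real^'n^'n) set"
  assumes "CARD('n) \<in> {2, 3}"
    and "subgroup G orthogonal_group"
    and "closed G"
    and "irreducible_matrices G"
    and "\<not> transitive_on_unit_sphere G"
  shows "finite G"
proof (rule ccontr)
  assume "infinite G"
  then obtain A where A: "tangent_at_identity G A" "A \<noteq> 0"
    using nonzero_tangent_at_identity[OF assms(2,3)] by blast
  obtain v :: "real^'n" where v: "norm v = 1"
    using vector_choose_size[of 1] by auto
  define K where "K = (\<lambda>A. A *v v) ` G"
  have orth: "norm (g *v w) = norm w" if "g \<in> G" for g w
    using orthogonal_matrix_inner[OF subgroup_orthogonal_matrix[OF assms(2) that]]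
    by (simp add: norm_eq)
  have "continuous_on G (\<lambda>A. A *v v)"
    unfolding continuous_on_def by (intro ballI tendsto_matrix_vector_mult tendsto_ident_at)
  then have "compact K"
    unfolding K_def by (intro compact_continuous_image compact_subgroup assms)
  have "v \<in> K"
    using subgroup_mat_1[OF assms(2)] unfolding K_def by force
  have K_sphere: "K \<subseteq> sphere 0 1"
    using orth v by (auto simp: K_def)
  have K_inv: "g *v x \<in> K" if "g \<in> G" "x \<in> K" for g x
    using that subgroup_matrix_mult[OF assms(2)] by (auto simp: K_def matrix_vector_mul_assoc)
  have "y \<in> K" if y: "norm y = 1" for y
  proof -
    \<comment> \<open>On the unit sphere, maximizing the inner product with \<open>y\<close> is the
      same as minimizing the distance to \<open>y\<close>.\<close>
    have "continuous_on K (\<lambda>k. k \<bullet> y)"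
      by (intro continuous_intros)
    then obtain x where x: "x \<in> K" and max: "\<And>k. k \<in> K \<Longrightarrow> k \<bullet> y \<le> x \<bullet> y"
      using continuous_attains_sup[of K "\<lambda>k. k \<bullet> y"] \<open>compact K\<close> \<open>v \<in> K\<close> by blast
    have nx: "norm x = 1"
      using x K_sphere by auto
    have "x = y \<or> x = - y"
      using assms(1) K_inv[OF _ x] max
      by (intro maximizer_parallel[OF assms(2) _ assms(4) A _ nx y]) auto
    moreover have "x \<noteq> - y"
    proof
      assume xy: "x = - y"
      \<comment> \<open>The maximum is -1, the least value possible for unit vectors, so every
        \<open>k\<close> in \<open>K\<close> attains it: the squared norm of \<open>k + y\<close> is
        \<open>2 + 2 * (k \<bullet> y)\<close>, at most 0.\<close>
      have fixed: "k = - y" if "k \<in> K" for k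
      proof -
        have "k \<bullet> y \<le> -1"
          using max[OF that] y by (simp add: xy norm_eq_1)
        moreover have "norm k = 1"
          using that K_sphere by auto
        ultimately have "(k + y) \<bullet> (k + y) \<le> 0"
          using y by (simp add: norm_eq_1 inner_add inner_commute)
        then have "k + y = 0"
          by (metis inner_eq_zero_iff inner_ge_zero order_antisym)
        then show ?thesis
          by (simp add: eq_neg_iff_add_eq_0)
      qed
      have "g *v y = y" if "g \<in> G" for g
        using fixed[OF K_inv[OF that x]] matrix_vector_mult_scaleR[of g "-1" y] by (simp add: xy)
      \<comment> \<open>A fixed \<open>y\<close> spans an invariant line, which is proper because
        the dimension is at least 2.\<close>
      then have "\<forall>g\<in>G. (\<lambda>v. g *v v) ` span {y} \<subseteq> span {y}"
        by (auto simp: span_singleton matrix_vector_mult_scaleR)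
      then have "span {y} = {0} \<or> span {y} = UNIV"
        using assms(4) unfolding irreducible_matrices_def by blast
      moreover have "y \<noteq> 0"
        using y by auto
      then have "span {y} \<noteq> {0}"
        using span_base[of y "{y}"] by auto
      ultimately have "dim (span {y}) = CARD('n)"
        by simp
      then show False
        using \<open>y \<noteq> 0\<close> assms(1) by (simp add: dim_insert)
    qed
    ultimately show ?thesis
      using x by simp
  qed
  then have "K = sphere 0 1"
    using K_sphere by auto
  then show False
    using assms(5) v unfolding transitive_on_unit_sphere_def K_def by auto
qed

end
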